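(* Let $\mu_0$ be a probability measure on $\mathscr{B}(\mathbb{R})$ with finite fourth moment and such that $\kappa_4(\tilde{\mu}_0)\neq 0$. Let $\sigma^2=\int_{\mathbb{R}}x^2\,\mu_0(dx)$, and let $\mu(\cdot,t)$, $t\ge 0$, be the solution of the (Fourier-transformed) Kac equation with initial datum $\mu_0$. Then there exists a strictly positive constant $C$, depending only on $\mu_0$, such that $$d_{\mathrm{TV}}(\mu(\cdot,t);\gamma_\sigma)\ \ge\ C\,e^{-t/4}\qquad\text{for every } t\ge 0.$$
   Context: Kac equation in Fourier form: for a probability measure $\mu_0$ on $\mathscr{B}(\mathbb{R})$ with characteristic function $\varphi_0(\xi)=\int e^{i\xi x}\mu_0(dx)$, consider $$\frac{\partial\varphi}{\partial t}(\xi,t)=\frac{1}{2\pi}\int_0^{2\pi}\varphi(\xi\cos\theta,t)\,\varphi(\xi\sin\theta,t)\,d\theta-\varphi(\xi,t),\qquad \varphi(\xi,0)=\varphi_0(\xi).$$ It has a unique solution $\varphi$, and for each $t\ge0$, $\varphi(\cdot,t)$ is the characteristic function of a probability measure $\mu(\cdot,t)$, called the solution with initial datum $\mu_0$. It is given by the Wild series $\varphi(\xi,t)=\sum_{n\ge1}e^{-t}(1-e^{-t})^{n-1}\hat q_n(\xi;\varphi_0)$ with $\hat q_1=\varphi_0$, $\hat q_n=\frac{1}{n-1}\sum_{k=1}^{n-1}\hat q_k\star\hat q_{n-k}$ $(n\ge2)$, where $(g_1\star g_2)(\xi)=\frac1{2\pi}\int_0^{2\pi}g_1(\xi\cos\theta)g_2(\xi\sin\theta)\,d\theta$.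 $\gamma_\sigma$ is the Gaussian distribution with mean $0$ and variance $\sigma^2$. For probability measures $P,Q$ on $\mathscr{B}(\mathbb{R})$ (the Borel class), $d_{\mathrm{TV}}(P;Q)=\sup_{B\in\mathscr{B}(\mathbb{R})}|P(B)-Q(B)|$. The symmetrized form of $\mu_0$ is $\tilde\mu_0(B)=\{\mu_0(B)+\mu_0(-B)\}/2$, $B\in\mathscr{B}(\mathbb{R})$, with $-B=\{x: -x\in B\}$. The fourth cumulant of a probability $Q$ on $\mathscr{B}(\mathbb{R})$ with finite fourth moment is $\kappa_4(Q)=\int(x-\overline Q)^4Q(dx)-3\left(\int(x-\overline Q)^2Q(dx)\right)^2$, where $\overline Q=\int x\,Q(dx)$. *)

theory Defs
  imports "HOL-Probability.Probability"
begin

definition kac_star :: "(real \<Rightarrow> complex) \<Rightarrow> (real \<Rightarrow> complex) \<Rightarrow> real \<Rightarrow> complex" where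
  "kac_star g1 g2 \<xi> =
     (1 / (2 * pi)) *\<^sub>R (LBINT \<theta>:{0..2 * pi}. g1 (\<xi> * cos \<theta>) * g2 (\<xi> * sin \<theta>))"

text \<open>The time derivative is the one-sided one at \<open>t = 0\<close>; values at negative times are irrelevant.\<close>

definition kac_fourier_solution ::
    "(real \<Rightarrow> complex) \<Rightarrow> (real \<Rightarrow> real \<Rightarrow> complex) \<Rightarrow> bool" where
  "kac_fourier_solution \<phi>0 \<phi> \<longleftrightarrow>
     (\<forall>\<xi>. \<phi> \<xi> 0 = \<phi>0 \<xi>) \<and>
     (\<forall>\<xi>. \<forall>t\<ge>0. ((\<lambda>s. \<phi> \<xi> s) has_vector_derivative
        (kac_star (\<lambda>x. \<phi> x t) (\<lambda>x. \<phi> x t) \<xi> - \<phi> \<xi> t)) (at t within {0..}))"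

definition kac_solution :: "real measure \<Rightarrow> (real \<Rightarrow> real measure) \<Rightarrow> bool" where
  "kac_solution \<mu>0 \<mu> \<longleftrightarrow>
     (\<forall>t\<ge>0. real_distribution (\<mu> t)) \<and>
     kac_fourier_solution (char \<mu>0) (\<lambda>\<xi> t. char (\<mu> t) \<xi>)"

text \<open>Meaningful for \<open>\<sigma> > 0\<close> only; for \<open>\<sigma> = 0\<close> this is the zero measure, not a point mass.\<close>

definition gaussian :: "real \<Rightarrow> real measure" where
  "gaussian \<sigma> = density lborel (\<lambda>x. ennreal (normal_density 0 \<sigma> x))"

definition tv_dist :: "real measure \<Rightarrow> real measure \<Rightarrow> real" where
  "tv_dist P Q = (SUP B\<in>sets borel. \<bar>measure P B - measure Q B\<bar>)"

definition symmetrized :: "real measure \<Rightarrow> real measure" where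
  "symmetrized M = measure_of UNIV (sets borel)
     (\<lambda>B. (emeasure M B + emeasure M {x. - x \<in> B}) / 2)"

definition fourth_cumulant :: "real measure \<Rightarrow> real" where
  "fourth_cumulant Q =
     (let m = (\<integral>x. x \<partial>Q) in
       (\<integral>x. (x - m) ^ 4 \<partial>Q) - 3 * (\<integral>x. (x - m)\<^sup>2 \<partial>Q)\<^sup>2)"

lemma sets_symmetrized [simp]: "sets (symmetrized M) = sets borel"
  unfolding symmetrized_def by (metis sets.sets_measure_of_eq space_borel)

lemma space_symmetrized [simp]: "space (symmetrized M) = UNIV"
  by (metis sets_eq_imp_space_eq sets_symmetrized space_borel)

lemma emeasure_symmetrized:
  assumes "real_distribution M" and B: "B \<in> sets borel"
  shows "emeasure (symmetrized M) B = (emeasure M B + emeasure M {x. - x \<in> B}) / 2"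
proof -
  interpret real_distribution M by fact
  have eq: "emeasure M {x. - x \<in> A} = emeasure (distr M borel uminus) A"
    if "A \<in> sets borel" for A
    using that by (subst emeasure_distr) (auto simp: vimage_def)
  have "emeasure (symmetrized M) B = (\<lambda>B. (emeasure M B + emeasure M {x. - x \<in> B}) / 2) B"
  proof (rule emeasure_measure_of[OF symmetrized_def])
    show "countably_additive (sets (symmetrized M))
        (\<lambda>B. (emeasure M B + emeasure M {x. - x \<in> B}) / 2)"
    proof (rule countably_additiveI)
      fix A :: "nat \<Rightarrow> real set"
      assume A: "range A \<subseteq> sets (symmetrized M)" "disjoint_family A"
      then have A': "range A \<subseteq> sets borel" and U: "(\<Union>i. A i) \<in> sets borel" by auto
      have "(\<Sum>i. (emeasure M (A i) + emeasure M {x. - x \<in> A i}) / 2) =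
            (\<Sum>i. emeasure M (A i) + emeasure (distr M borel uminus) (A i)) / 2"
        using A' by (subst eq) (auto simp: divide_ennreal_def)
      also have "\<dots> = ((\<Sum>i. emeasure M (A i)) + (\<Sum>i. emeasure (distr M borel uminus) (A i))) / 2"
        by (subst suminf_add) auto
      also have "\<dots> = (emeasure M (\<Union>i. A i) + emeasure (distr M borel uminus) (\<Union>i. A i)) / 2"
        using A A' by (subst (1 2) suminf_emeasure) auto
      finally show "(\<Sum>i. (emeasure M (A i) + emeasure M {x. - x \<in> A i}) / 2) =
          (emeasure M (\<Union>i. A i) + emeasure M {x. - x \<in> (\<Union>i. A i)}) / 2"
        using eq[OF U] by simp
    qed
  qed (use B in \<open>auto simp: positive_def\<close>)
  then show ?thesis by simp
qed

end

theory Submission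
  imports Defs "HOL-Real_Asymp.Real_Asymp"
begin

text \<open>
  The real part \<open>u\<close> of the characteristic function of \<open>\<mu> t\<close> again solves the Kac equation, because the
  product of the (odd) imaginary parts averages to zero over the circle. Let \<open>g\<close> be the Gaussian
  characteristic function, a stationary solution, and \<open>w = u - g\<close>. At time \<open>0\<close> one has
  \<open>w \<xi> = k * \<xi> ^ 4 + o(\<xi> ^ 4)\<close> with \<open>24 * k\<close> the fourth cumulant. As \<open>cos\<^sup>4 + sin\<^sup>4\<close> has mean
  \<open>3/4\<close>, the comparison functions \<open>a * \<xi> ^ 4 * exp (- t / 4)\<close> are exact solutions of the equation
  linearized at \<open>u = 1\<close>. This first gives \<open>w = O(\<xi> ^ 4 * exp (- t / 4))\<close>, and then, since the
  linearization error is \<open>O(\<xi> ^ 6 * exp (- t / 4))\<close> and \<open>cos\<^sup>6 + sin\<^sup>6\<close> has the smaller mean \<open>5/8\<close>,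
  that \<open>w\<close> stays close to \<open>k * \<xi> ^ 4 * exp (- t / 4)\<close> for one fixed small \<open>\<xi>\<close> and all times.
  Finally \<open>\<bar>w \<xi>\<bar>\<close> is at most twice the total variation distance.
\<close>

section \<open>Differential inequalities and a comparison principle\<close>

lemma abs_le_of_abs_deriv_le:
  fixes f h :: "real \<Rightarrow> real"
  assumes f: "\<And>x. x \<ge> 0 \<Longrightarrow> (f has_real_derivative f' x) (at x within {0..})"
    and h: "\<And>x. x \<ge> 0 \<Longrightarrow> (h has_real_derivative h' x) (at x within {0..})"
    and le: "\<And>x. x \<ge> 0 \<Longrightarrow> \<bar>f' x\<bar> \<le> h' x"
    and init: "\<bar>f 0\<bar> \<le> h 0"
    and t: "t \<ge> 0"
  shows "\<bar>f t\<bar> \<le> h t"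
proof -
  have mono: "F 0 \<le> F t"
    if der: "\<And>x. x \<ge> 0 \<Longrightarrow> (F has_real_derivative F' x) (at x within {0..})"
      and nonneg: "\<And>x. x \<ge> 0 \<Longrightarrow> 0 \<le> F' x" for F F' :: "real \<Rightarrow> real"
  proof (rule DERIV_nonneg_imp_increasing_open[OF t])
    fix x :: real assume "0 < x"
    \<comment> \<open>At interior points the derivative is two-sided; at \<open>0\<close> the
      one-sided derivative enters through continuity only.\<close>
    then have "at x within {0..} = at x"
      by (intro at_within_interior) auto
    with der[of x] nonneg[of x] \<open>0 < x\<close> show "\<exists>y. (F has_real_derivative y) (at x) \<and> 0 \<le> y"
      by auto
  next
    have "continuous_on {0..} F"
      using der by (intro DERIV_continuous_on) auto
    then show "continuous_on {0..t} F"
      by (rule continuous_on_subset) auto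
  qed
  have "h 0 - f 0 \<le> h t - f t"
  proof (rule mono)
    show "((\<lambda>x. h x - f x) has_real_derivative h' x - f' x) (at x within {0..})" if "x \<ge> 0" for x
      using f[OF that] h[OF that] by (rule DERIV_diff[rotated])
    show "0 \<le> h' x - f' x" if "x \<ge> 0" for x
      using le[OF that] by simp
  qed
  moreover have "h 0 + f 0 \<le> h t + f t"
  proof (rule mono)
    show "((\<lambda>x. h x + f x) has_real_derivative h' x + f' x) (at x within {0..})" if "x \<ge> 0" for x
      using f[OF that] h[OF that] by (rule DERIV_add[rotated])
    show "0 \<le> h' x + f' x" if "x \<ge> 0" for x
      using le[OF that] by simp
  qed
  ultimately show ?thesis
    using init by linarith
qed

text \<open>
  No regularity of \<open>z\<close> in \<open>\<xi>\<close> is available, so the maximum principle is replaced by iterating \<open>step\<close>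
  from the crude bound \<open>K\<close>; after \<open>n\<close> rounds the excess is at most \<open>K * (2 * t) ^ n / n!\<close>.
\<close>

lemma kac_comparison:
  fixes z G :: "real \<Rightarrow> real \<Rightarrow> real" and a :: "real \<Rightarrow> real"
  assumes der: "\<And>\<xi> t. \<bar>\<xi>\<bar> \<le> r \<Longrightarrow> t \<ge> 0 \<Longrightarrow>
      (z \<xi> has_real_derivative G \<xi> t - z \<xi> t) (at t within {0..})"
    and bdd: "\<And>\<xi> t. \<bar>\<xi>\<bar> \<le> r \<Longrightarrow> t \<ge> 0 \<Longrightarrow> \<bar>z \<xi> t\<bar> \<le> K"
    and init: "\<And>\<xi>. \<bar>\<xi>\<bar> \<le> r \<Longrightarrow> \<bar>z \<xi> 0\<bar> \<le> a \<xi>"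
    and step: "\<And>\<xi> t \<kappa>. t \<ge> 0 \<Longrightarrow> \<kappa> \<ge> 0 \<Longrightarrow> \<bar>\<xi>\<bar> \<le> r \<Longrightarrow>
      (\<And>\<eta>. \<bar>\<eta>\<bar> \<le> r \<Longrightarrow> \<bar>z \<eta> t\<bar> \<le> a \<eta> * exp (- t / 4) + \<kappa>) \<Longrightarrow>
      \<bar>G \<xi> t\<bar> \<le> 3 / 4 * a \<xi> * exp (- t / 4) + 2 * \<kappa>"
    and \<xi>: "\<bar>\<xi>\<bar> \<le> r" and t: "t \<ge> 0"
  shows "\<bar>z \<xi> t\<bar> \<le> a \<xi> * exp (- t / 4)"
proof -
  have K: "K \<ge> 0"
    using bdd[OF \<xi> t] by linarith
  have iter: "\<bar>z \<xi> t\<bar> \<le> a \<xi> * exp (- t / 4) + K * (2 * t) ^ n / fact n"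
    if "\<bar>\<xi>\<bar> \<le> r" "t \<ge> 0" for n \<xi> t
    using that
  proof (induction n arbitrary: \<xi> t)
    case 0
    have "0 \<le> a \<xi>"
      using init[OF 0(1)] by linarith
    then have "0 \<le> a \<xi> * exp (- t / 4)"
      by simp
    then show ?case
      using bdd[OF 0] by simp
  next
    case (Suc n)
    \<comment> \<open>The integrating factor \<open>exp s\<close> turns the equation into:
      \<open>?f\<close> has derivative \<open>exp s * G \<xi> s\<close>. \<open>?h\<close> is
      \<open>exp s\<close> times the bound claimed for \<open>Suc n\<close>. Differentiating its
      first term produces the factor \<open>3 / 4\<close>, which is why that factor in
      \<open>step\<close> goes with the rate \<open>exp (- t / 4)\<close>.\<close>
    let ?f = "\<lambda>s. exp s * z \<xi> s"
    let ?h = "\<lambda>s. a \<xi> * exp (3 / 4 * s) + exp s * (K * (2 * s) ^ Suc n / fact (Suc n))"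
    let ?h' = "\<lambda>s. 3 / 4 * a \<xi> * exp (3 / 4 * s) + (exp s * (2 * (K * (2 * s) ^ n / fact n))
      + exp s * (K * (2 * s) ^ Suc n / fact (Suc n)))"
    have "\<bar>?f t\<bar> \<le> ?h t"
    proof (rule abs_le_of_abs_deriv_le[where f = ?f and h = ?h and f' = "\<lambda>s. exp s * G \<xi> s" and h' = ?h'])
      fix s :: real assume s: "s \<ge> 0"
      show "(?f has_real_derivative exp s * G \<xi> s) (at s within {0..})"
        using der[OF Suc.prems(1) s]
        by (auto intro!: derivative_eq_intros simp: algebra_simps)
      have "((\<lambda>s. 2 * s) has_real_derivative 2) (at s within {0..})"
        by (auto intro!: derivative_eq_intros)
      then have "((\<lambda>s. K * (2 * s) ^ Suc n / fact (Suc n)) has_real_derivative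
          K * ((1 + real n) * (2 * (2 * s) ^ n)) / fact (Suc n)) (at s within {0..})"
        by (intro DERIV_cdivide DERIV_cmult DERIV_power_Suc)
      also have "K * ((1 + real n) * (2 * (2 * s) ^ n)) / fact (Suc n) = 2 * (K * (2 * s) ^ n / fact n)"
        by (simp add: field_simps del: of_nat_Suc flip: of_nat_Suc)
      finally have "((\<lambda>s. exp s * (K * (2 * s) ^ Suc n / fact (Suc n))) has_real_derivative
          exp s * (2 * (K * (2 * s) ^ n / fact n)) + exp s * (K * (2 * s) ^ Suc n / fact (Suc n)))
          (at s within {0..})"
        by (rule DERIV_mult'[OF DERIV_subset[OF DERIV_exp subset_UNIV]])
      moreover have "((\<lambda>s. a \<xi> * exp (3 / 4 * s)) has_real_derivative
          3 / 4 * a \<xi> * exp (3 / 4 * s)) (at s within {0..})"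
        by (auto intro!: derivative_eq_intros)
      ultimately show "(?h has_real_derivative ?h' s) (at s within {0..})"
        by (rule DERIV_add[rotated])
      have "\<bar>G \<xi> s\<bar> \<le> 3 / 4 * a \<xi> * exp (- s / 4) + 2 * (K * (2 * s) ^ n / fact n)"
        using K s by (intro step Suc.prems Suc.IH) auto
      then have "exp s * \<bar>G \<xi> s\<bar> \<le> exp s * (3 / 4 * a \<xi> * exp (- s / 4) + 2 * (K * (2 * s) ^ n / fact n))"
        by (rule mult_left_mono) simp
      also have "\<dots> = 3 / 4 * a \<xi> * (exp s * exp (- s / 4)) + exp s * (2 * (K * (2 * s) ^ n / fact n))"
        by (simp add: algebra_simps)
      also have "exp s * exp (- s / 4) = exp (3 / 4 * s)"
        by (simp flip: exp_add)
      \<comment> \<open>The last summand of \<open>?h'\<close>, coming from the derivative of the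
        outer \<open>exp s\<close>, is nonnegative and is given away.\<close>
      also have "3 / 4 * a \<xi> * exp (3 / 4 * s) + exp s * (2 * (K * (2 * s) ^ n / fact n)) \<le> ?h' s"
        using K s by simp
      finally show "\<bar>exp s * G \<xi> s\<bar> \<le> ?h' s"
        by (simp add: abs_mult)
    qed (use init Suc.prems in auto)
    also have "?h t = exp t * (a \<xi> * exp (- t / 4) + K * (2 * t) ^ Suc n / fact (Suc n))"
    proof -
      have "exp (3 / 4 * t) = exp t * exp (- t / 4)"
        by (simp flip: exp_add)
      then show ?thesis
        by (simp only: algebra_simps)
    qed
    finally show ?case
      by (simp add: abs_mult del: fact_Suc power_Suc)
  qed
  have "(\<lambda>n. K * (inverse (fact n) * (2 * t) ^ n)) \<longlonglongrightarrow> K * 0"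
    by (intro tendsto_mult tendsto_const summable_LIMSEQ_zero summable_exp)
  then have "(\<lambda>n. a \<xi> * exp (- t / 4) + K * (2 * t) ^ n / fact n) \<longlonglongrightarrow> a \<xi> * exp (- t / 4) + 0"
    by (intro tendsto_add tendsto_const) (simp add: field_simps)
  then show ?thesis
    using iter[OF \<xi> t] by (intro LIMSEQ_le_const[where X = "\<lambda>n. a \<xi> * exp (- t / 4) + K * (2 * t) ^ n / fact n"]) auto
qed

section \<open>Averages over the circle\<close>

definition circle_mean :: "(real \<Rightarrow> real) \<Rightarrow> real" where
  "circle_mean f = integral {0..2 * pi} f / (2 * pi)"

text \<open>Two double-angle formulas make the integrand \<open>(1 - cos (4 * x)) / 8\<close>, so
  its mean over the circle is \<open>1 / 8\<close>.\<close>

lemma has_integral_sin2_cos2: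
  "((\<lambda>x::real. (sin x * cos x)\<^sup>2) has_integral pi / 4) {0..2 * pi}"
proof -
  let ?F = "\<lambda>x::real. x / 8 - sin (4 * x) / 32"
  have "((\<lambda>x::real. (sin x * cos x)\<^sup>2) has_integral ?F (2 * pi) - ?F 0) {0..2 * pi}"
  proof (rule fundamental_theorem_of_calculus)
    fix x :: real
    have "cos (4 * x) = 1 - 2 * (sin (2 * x))\<^sup>2"
      using cos_double_sin[of "2 * x"] by simp
    also have "sin (2 * x) = 2 * sin x * cos x"
      by (rule sin_double)
    finally have *: "cos (4 * x) = 1 - 8 * (sin x * cos x)\<^sup>2"
      by (simp add: power2_eq_square)
    have "(?F has_real_derivative (1 - cos (4 * x)) / 8) (at x within {0..2 * pi})"
      by (auto intro!: derivative_eq_intros simp: field_simps)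
    then show "(?F has_vector_derivative (sin x * cos x)\<^sup>2) (at x within {0..2 * pi})"
      using * by (simp add: has_real_derivative_iff_has_vector_derivative)
  qed simp
  moreover have "sin (8 * pi) = (0::real)"
    using sin_npi[of 8] by simp
  ultimately show ?thesis
    by (simp add: field_simps)
qed

lemma cos4_sin4: "(cos x) ^ 4 + (sin x) ^ 4 = 1 - 2 * (sin x * cos x)\<^sup>2" for x :: real
proof -
  have "cos x ^ 4 + sin x ^ 4 = ((cos x)\<^sup>2 + (sin x)\<^sup>2)\<^sup>2 - 2 * (sin x * cos x)\<^sup>2"
    by algebra
  then show ?thesis
    by simp
qed

lemma cos6_sin6: "(cos x) ^ 6 + (sin x) ^ 6 = 1 - 3 * (sin x * cos x)\<^sup>2" for x :: real
proof -
  have "cos x ^ 6 + sin x ^ 6 = ((cos x)\<^sup>2 + (sin x)\<^sup>2) ^ 3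
      - 3 * (sin x * cos x)\<^sup>2 * ((cos x)\<^sup>2 + (sin x)\<^sup>2)"
    by algebra
  then show ?thesis
    by simp
qed

text \<open>As \<open>(sin x * cos x)\<^sup>2\<close> has mean \<open>1 / 8\<close>, a pointwise
  estimate affine in it averages by replacing it with \<open>1 / 8\<close>. By
  \<open>cos4_sin4\<close> and \<open>cos6_sin6\<close> the averages needed later have this shape.
  The coefficient \<open>q\<close> may be negative: \<open>3 / 4\<close> arises as
  \<open>1 - 2 / 8\<close>.\<close>

lemma circle_mean_approx:
  assumes f: "continuous_on {0..2 * pi} f"
    and le: "\<And>x. \<bar>f x - (p0 + q0 * (sin x * cos x)\<^sup>2)\<bar> \<le> p + q * (sin x * cos x)\<^sup>2"
  shows "\<bar>circle_mean f - (p0 + q0 / 8)\<bar> \<le> p + q / 8"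
proof -
  have trig: "((\<lambda>x. c + d * (sin x * cos x)\<^sup>2) has_integral c * (2 * pi) + d * (pi / 4)) {0..2 * pi}"
    for c d :: real
    using has_integral_add[OF has_integral_const_real[of c 0 "2 * pi"]
        has_integral_mult_right[OF has_integral_sin2_cos2, of d]]
    by (simp add: mult.commute)
  have fi: "(f has_integral circle_mean f * (2 * pi)) {0..2 * pi}"
    using integrable_integral[OF integrable_continuous_interval[OF f]] by (simp add: circle_mean_def)
  have "circle_mean f * (2 * pi) \<le> (p0 + p) * (2 * pi) + (q0 + q) * (pi / 4)"
    using le by (intro has_integral_le[OF fi trig]) (simp add: abs_le_iff algebra_simps)
  then have "circle_mean f * (2 * pi) \<le> (p0 + p + (q0 + q) / 8) * (2 * pi)"
    by (simp add: field_simps)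
  then have upper: "circle_mean f \<le> p0 + p + (q0 + q) / 8"
    by simp
  have "(p0 - p) * (2 * pi) + (q0 - q) * (pi / 4) \<le> circle_mean f * (2 * pi)"
    using le by (intro has_integral_le[OF trig fi]) (simp add: abs_le_iff algebra_simps)
  then have "(p0 - p + (q0 - q) / 8) * (2 * pi) \<le> circle_mean f * (2 * pi)"
    by (simp add: field_simps)
  then have "p0 - p + (q0 - q) / 8 \<le> circle_mean f"
    by simp
  with upper show ?thesis
    by (simp add: abs_le_iff algebra_simps add_divide_distrib diff_divide_distrib)
qed

section \<open>Closeness to the Gaussian at low frequencies\<close>

lemma kac_near_gaussian:
  fixes u :: "real \<Rightarrow> real \<Rightarrow> real" and k \<epsilon> \<sigma> r :: real
  defines "A \<equiv> \<bar>k\<bar> + \<epsilon>"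
  defines "B \<equiv> A + \<sigma>\<^sup>2 / 2"
  defines "g \<equiv> \<lambda>\<xi>. exp (- (\<sigma> * \<xi>)\<^sup>2 / 2)"
  assumes der: "\<And>\<xi> t. t \<ge> 0 \<Longrightarrow> (u \<xi> has_real_derivative
      circle_mean (\<lambda>\<theta>. u (\<xi> * cos \<theta>) t * u (\<xi> * sin \<theta>) t) - u \<xi> t) (at t within {0..})"
    and cont: "\<And>t. t \<ge> 0 \<Longrightarrow> continuous_on UNIV (\<lambda>\<xi>. u \<xi> t)"
    and bdd: "\<And>\<xi> t. t \<ge> 0 \<Longrightarrow> \<bar>u \<xi> t\<bar> \<le> 1"
    and init: "\<And>\<xi>. \<bar>\<xi>\<bar> \<le> r \<Longrightarrow> \<bar>u \<xi> 0 - g \<xi> - k * \<xi> ^ 4\<bar> \<le> \<epsilon> * \<xi> ^ 4"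
    and r: "r \<le> 1" and \<epsilon>: "\<epsilon> \<ge> 0"
    and \<xi>: "\<bar>\<xi>\<bar> \<le> r" and t: "t \<ge> 0"
  shows "\<bar>u \<xi> t - g \<xi> - k * \<xi> ^ 4 * exp (- t / 4)\<bar> \<le> (\<epsilon> * \<xi> ^ 4 + A * B * \<xi> ^ 6) * exp (- t / 4)"
proof -
  \<comment> \<open>\<open>A * x ^ 4\<close> will bound the distance from \<open>u\<close> to
    \<open>g\<close>, and \<open>B * x\<^sup>2\<close> the distances from \<open>u\<close> and
    \<open>g\<close> to \<open>1\<close>. The error term with \<open>A * B\<close> comes from
    products of the two.\<close>
  have A: "A \<ge> 0" and B: "B \<ge> 0"
    using \<epsilon> by (auto simp: A_def B_def)
  have g01: "0 \<le> g x" "g x \<le> 1" for x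
    by (auto simp: g_def)
  have gg: "g (x * cos y) * g (x * sin y) = g x" for x y
  proof -
    have "g (x * cos y) * g (x * sin y) = exp (- (\<sigma> * x)\<^sup>2 * ((cos y)\<^sup>2 + (sin y)\<^sup>2) / 2)"
      unfolding g_def exp_add[symmetric] by (rule arg_cong[where f = exp]) algebra
    then show ?thesis
      by (simp add: g_def)
  qed
  have contp: "continuous_on {0..2 * pi} (\<lambda>\<theta>. u (x * cos \<theta>) s * u (x * sin \<theta>) s)" if "s \<ge> 0" for x s
    by (intro continuous_intros continuous_on_compose2[OF cont[OF that]]) auto
  \<comment> \<open>The equation couples a frequency only to frequencies of no larger modulus, so
    the estimates close on \<open>\<bar>\<xi>\<bar> \<le> r\<close>.\<close>
  have small: "\<bar>x * cos y\<bar> \<le> r" "\<bar>x * sin y\<bar> \<le> r" if "\<bar>x\<bar> \<le> r" for x y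
    using that mult_left_le[of "\<bar>cos y\<bar>" "\<bar>x\<bar>"] mult_left_le[of "\<bar>sin y\<bar>" "\<bar>x\<bar>"]
    by (auto simp: abs_mult)
  have first: "\<bar>u x s - g x\<bar> \<le> A * x ^ 4 * exp (- s / 4)" if "\<bar>x\<bar> \<le> r" "s \<ge> 0" for x s
  proof (rule kac_comparison[where z = "\<lambda>x s. u x s - g x" and a = "\<lambda>x. A * x ^ 4" and r = r and K = 2
        and G = "\<lambda>x s. circle_mean (\<lambda>\<theta>. u (x * cos \<theta>) s * u (x * sin \<theta>) s) - g x"])
    fix x s :: real assume "s \<ge> 0" "\<bar>x\<bar> \<le> r"
    show "((\<lambda>s. u x s - g x) has_real_derivative
        circle_mean (\<lambda>\<theta>. u (x * cos \<theta>) s * u (x * sin \<theta>) s) - g x - (u x s - g x)) (at s within {0..})"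
      by (auto intro!: derivative_eq_intros der[OF \<open>s \<ge> 0\<close>])
    show "\<bar>u x s - g x\<bar> \<le> 2"
      using bdd[OF \<open>s \<ge> 0\<close>, of x] g01[of x] by linarith
  next
    fix x :: real assume "\<bar>x\<bar> \<le> r"
    have "\<bar>k * x ^ 4\<bar> = \<bar>k\<bar> * x ^ 4"
      by (simp add: abs_mult)
    with init[OF \<open>\<bar>x\<bar> \<le> r\<close>] show "\<bar>u x 0 - g x\<bar> \<le> A * x ^ 4"
      unfolding A_def distrib_right by linarith
  next
    fix x s \<kappa> :: real
    assume s: "s \<ge> 0" and "\<kappa> \<ge> 0" and x: "\<bar>x\<bar> \<le> r"
      and le: "\<And>y. \<bar>y\<bar> \<le> r \<Longrightarrow> \<bar>u y s - g y\<bar> \<le> A * y ^ 4 * exp (- s / 4) + \<kappa>"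
    let ?E = "A * x ^ 4 * exp (- s / 4)"
    have "\<bar>circle_mean (\<lambda>\<theta>. u (x * cos \<theta>) s * u (x * sin \<theta>) s) - (g x + 0 / 8)\<bar>
        \<le> ?E + 2 * \<kappa> + (- 2 * ?E) / 8"
    proof (rule circle_mean_approx[OF contp[OF s]])
      fix y :: real
      let ?c = "x * cos y" and ?s = "x * sin y"
      \<comment> \<open>Telescoping around the stationary \<open>g\<close>: the other factors are
        bounded by \<open>1\<close>, so each deviation enters once, and the slack becomes
        \<open>2 * \<kappa>\<close>.\<close>
      have "u ?c s * u ?s s - g x = (u ?c s - g ?c) * u ?s s + g ?c * (u ?s s - g ?s)"
        using gg[of x y] by (simp add: algebra_simps)
      also have "\<bar>\<dots>\<bar> \<le> \<bar>u ?c s - g ?c\<bar> * 1 + 1 * \<bar>u ?s s - g ?s\<bar>"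
        using bdd[OF s, of ?s] g01[of ?c]
        by (intro order_trans[OF abs_triangle_ineq] add_mono)
          (auto simp: abs_mult intro!: mult_left_le mult_left_le_one_le)
      also have "\<dots> \<le> (A * ?c ^ 4 * exp (- s / 4) + \<kappa>) + (A * ?s ^ 4 * exp (- s / 4) + \<kappa>)"
        using add_mono[OF le[OF small(1)[OF x, of y]] le[OF small(2)[OF x, of y]]] by simp
      also have "\<dots> = ?E * (cos y ^ 4 + sin y ^ 4) + 2 * \<kappa>"
        by (simp add: algebra_simps power_mult_distrib)
      finally show "\<bar>u ?c s * u ?s s - (g x + 0 * (sin y * cos y)\<^sup>2)\<bar>
          \<le> ?E + 2 * \<kappa> + (- 2 * ?E) * (sin y * cos y)\<^sup>2"
        unfolding cos4_sin4 by (simp add: algebra_simps)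
    qed
    then show "\<bar>circle_mean (\<lambda>\<theta>. u (x * cos \<theta>) s * u (x * sin \<theta>) s) - g x\<bar>
        \<le> 3 / 4 * (A * x ^ 4) * exp (- s / 4) + 2 * \<kappa>"
      by simp
  qed (use that in auto)
  have g1: "\<bar>g x - 1\<bar> \<le> B * x\<^sup>2" for x
  proof -
    have "1 + (- (\<sigma> * x)\<^sup>2 / 2) \<le> g x"
      unfolding g_def by (rule exp_ge_add_one_self)
    moreover have "(\<sigma> * x)\<^sup>2 / 2 \<le> B * x\<^sup>2"
      using A by (simp add: B_def power_mult_distrib distrib_right)
    ultimately show ?thesis
      using g01[of x] by linarith
  qed
  \<comment> \<open>From above \<open>\<bar>u\<bar> \<le> 1\<close> suffices; from below
    \<open>u\<close> is compared with \<open>g\<close> by \<open>first\<close>, where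
    \<open>r \<le> 1\<close> lets \<open>x\<^sup>2\<close> dominate \<open>x ^ 4\<close>.\<close>
  have u1: "\<bar>u x s - 1\<bar> \<le> B * x\<^sup>2" if x: "\<bar>x\<bar> \<le> r" and s: "s \<ge> 0" for x s
  proof -
    have "x\<^sup>2 \<le> 1"
      using x r by (intro abs_square_le_1[THEN iffD2]) simp
    then have "x ^ 4 \<le> x\<^sup>2"
      using mult_left_le[of "x\<^sup>2" "x\<^sup>2"] by (simp flip: power_add)
    have "A * x ^ 4 * exp (- s / 4) \<le> A * x ^ 4"
      using A s by (intro mult_left_le) auto
    also have "\<dots> \<le> A * x\<^sup>2"
      using A \<open>x ^ 4 \<le> x\<^sup>2\<close> by (rule mult_left_mono[rotated])
    finally have "\<bar>u x s - g x\<bar> \<le> A * x\<^sup>2"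
      using first[OF x s] by linarith
    moreover have "1 + (- (\<sigma> * x)\<^sup>2 / 2) \<le> g x"
      unfolding g_def by (rule exp_ge_add_one_self)
    moreover have "(\<sigma> * x)\<^sup>2 / 2 = \<sigma>\<^sup>2 / 2 * x\<^sup>2"
      by (simp add: power_mult_distrib)
    ultimately show ?thesis
      using g01[of x] bdd[OF s, of x] unfolding B_def distrib_right by linarith
  qed
  \<comment> \<open>The subtracted profile decays at rate \<open>1 / 4\<close>, which leaves
    \<open>3 / 4\<close> of it inside \<open>?G\<close>. The same \<open>3 / 4\<close> is the mean
    of \<open>cos y ^ 4 + sin y ^ 4\<close>, so the profile cancels at leading order.\<close>
  let ?G = "\<lambda>x s. circle_mean (\<lambda>\<theta>. u (x * cos \<theta>) s * u (x * sin \<theta>) s) - g x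
    - 3 / 4 * k * x ^ 4 * exp (- s / 4)"
  show ?thesis
  proof (rule kac_comparison[where z = "\<lambda>x s. u x s - g x - k * x ^ 4 * exp (- s / 4)"
        and a = "\<lambda>x. \<epsilon> * x ^ 4 + A * B * x ^ 6" and r = r and K = "2 + \<bar>k\<bar>" and G = ?G])
    fix x s :: real assume s: "s \<ge> 0" and x: "\<bar>x\<bar> \<le> r"
    show "((\<lambda>s. u x s - g x - k * x ^ 4 * exp (- s / 4)) has_real_derivative
        ?G x s - (u x s - g x - k * x ^ 4 * exp (- s / 4))) (at s within {0..})"
      by (auto intro!: derivative_eq_intros der[OF s] simp: algebra_simps)
    have "x ^ 4 \<le> 1"
      using x r power_le_one[of "\<bar>x\<bar>" 4] by simp
    then have "x ^ 4 * exp (- s / 4) \<le> 1"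
      using s by (intro mult_le_one) auto
    then have "\<bar>k\<bar> * (x ^ 4 * exp (- s / 4)) \<le> \<bar>k\<bar>"
      by (intro mult_left_le) auto
    then have "\<bar>k * x ^ 4 * exp (- s / 4)\<bar> \<le> \<bar>k\<bar>"
      by (simp add: abs_mult mult.assoc)
    then show "\<bar>u x s - g x - k * x ^ 4 * exp (- s / 4)\<bar> \<le> 2 + \<bar>k\<bar>"
      using bdd[OF s, of x] g01[of x] by linarith
  next
    fix x :: real assume "\<bar>x\<bar> \<le> r"
    moreover have "0 \<le> A * B * x ^ 6"
      using A B by simp
    ultimately show "\<bar>u x 0 - g x - k * x ^ 4 * exp (- 0 / 4)\<bar> \<le> \<epsilon> * x ^ 4 + A * B * x ^ 6"
      using init[of x] by simp
  next
    fix x s \<kappa> :: real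
    assume s: "s \<ge> 0" and "\<kappa> \<ge> 0" and x: "\<bar>x\<bar> \<le> r"
      and le: "\<And>y. \<bar>y\<bar> \<le> r \<Longrightarrow> \<bar>u y s - g y - k * y ^ 4 * exp (- s / 4)\<bar>
        \<le> (\<epsilon> * y ^ 4 + A * B * y ^ 6) * exp (- s / 4) + \<kappa>"
    define e where "e = exp (- s / 4)"
    have e: "0 \<le> e"
      by (simp add: e_def)
    let ?X = "k * x ^ 4 * e" and ?D = "\<epsilon> * x ^ 4 * e" and ?E = "A * B * x ^ 6 * e"
    \<comment> \<open>For \<open>?E\<close> the sixth powers contribute \<open>5 / 8\<close> and the
      nonlinear remainder \<open>1 / 8\<close>. Their sum is exactly the \<open>3 / 4\<close> that
      the comparison allows, which fixes the coefficient \<open>A * B\<close>.\<close>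
    have "\<bar>circle_mean (\<lambda>\<theta>. u (x * cos \<theta>) s * u (x * sin \<theta>) s) - (g x + ?X + (- 2 * ?X) / 8)\<bar>
        \<le> ?D + ?E + 2 * \<kappa> + (- 2 * ?D - 3 * ?E + ?E) / 8"
    proof (rule circle_mean_approx[OF contp[OF s]])
      fix y :: real
      let ?c = "x * cos y" and ?s = "x * sin y"
      note sc = small(1)[OF x, of y] and ss = small(2)[OF x, of y]
      let ?z = "\<lambda>y. u y s - g y - k * y ^ 4 * e"
      have eq: "g x + ?X + (- 2 * ?X) * (sin y * cos y)\<^sup>2 = g x + ?X * (cos y ^ 4 + sin y ^ 4)"
        unfolding cos4_sin4 by (simp add: algebra_simps)
      \<comment> \<open>Linearization at \<open>1\<close>: each remainder product pairs a deviation
        from \<open>g\<close>, of fourth order by \<open>first\<close>, with a deviation from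
        \<open>1\<close>, of second order, so the remainder is of order
        \<open>x ^ 6\<close>.\<close>
      have "u ?c s * u ?s s - (g x + ?X + (- 2 * ?X) * (sin y * cos y)\<^sup>2)
          = (?z ?c + ?z ?s) + (u ?c s - g ?c) * (u ?s s - 1) + (g ?c - 1) * (u ?s s - g ?s)"
        unfolding eq using gg[of x y] by (simp add: algebra_simps power_mult_distrib)
      also have "\<bar>\<dots>\<bar> \<le> (((\<epsilon> * ?c ^ 4 + A * B * ?c ^ 6) * e + \<kappa>)
          + ((\<epsilon> * ?s ^ 4 + A * B * ?s ^ 6) * e + \<kappa>))
          + (A * ?c ^ 4 * e) * (B * ?s\<^sup>2) + (B * ?c\<^sup>2) * (A * ?s ^ 4 * e)"
        using le[OF sc] le[OF ss] first[OF sc s] first[OF ss s] u1[OF ss s] g1[of ?c] A B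
        by (intro order_trans[OF abs_triangle_ineq] add_mono)
          (auto simp: abs_mult e_def intro!: mult_mono)
      also have "\<dots> = ?D * (cos y ^ 4 + sin y ^ 4) + ?E * (cos y ^ 6 + sin y ^ 6) + 2 * \<kappa>
          + ?E * (sin y * cos y)\<^sup>2 * ((sin y)\<^sup>2 + (cos y)\<^sup>2)"
        by algebra
      finally show "\<bar>u ?c s * u ?s s - (g x + ?X + (- 2 * ?X) * (sin y * cos y)\<^sup>2)\<bar>
          \<le> ?D + ?E + 2 * \<kappa> + (- 2 * ?D - 3 * ?E + ?E) * (sin y * cos y)\<^sup>2"
        unfolding cos4_sin4 cos6_sin6 by (simp add: algebra_simps)
    qed
    then show "\<bar>?G x s\<bar> \<le> 3 / 4 * (\<epsilon> * x ^ 4 + A * B * x ^ 6) * exp (- s / 4) + 2 * \<kappa>"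
      unfolding e_def[symmetric] by (simp add: field_simps)
  qed (use \<xi> t in auto)
qed

section \<open>Total variation and characteristic functions\<close>

lemma measure_diff_le_tv_dist:
  assumes "real_distribution P" "real_distribution Q" "B \<in> sets borel"
  shows "\<bar>measure P B - measure Q B\<bar> \<le> tv_dist P Q"
proof -
  interpret P: real_distribution P by fact
  interpret Q: real_distribution Q by fact
  \<comment> \<open>A real supremum dominates its members once the set is known to be bounded
    above.\<close>
  have "\<bar>P.prob B - Q.prob B\<bar> \<le> 1" for B
    using P.prob_le_1[of B] Q.prob_le_1[of B] measure_nonneg[of P B] measure_nonneg[of Q B]
    by linarith
  then show ?thesis
    unfolding tv_dist_def by (intro cSUP_upper bdd_aboveI2[where M = 1] assms)
qed

lemma integral_diff_le_tv_dist:
  fixes f :: "real \<Rightarrow> real"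
  assumes P: "real_distribution P" and Q: "real_distribution Q"
    and f [measurable]: "f \<in> borel_measurable borel" and f01: "\<And>x. 0 \<le> f x" "\<And>x. f x \<le> 1"
  shows "\<bar>(\<integral>x. f x \<partial>P) - (\<integral>x. f x \<partial>Q)\<bar> \<le> tv_dist P Q"
proof -
  \<comment> \<open>Discretized layer cake: \<open>f\<close> is within \<open>1/n\<close> of the mean of the indicators of these level sets.\<close>
  define S where "S n j = {x. real j \<le> real n * f x}" for n j :: nat
  have S [measurable]: "S n j \<in> sets borel" for n j
    unfolding S_def by measurable
  have approx: "\<bar>(\<integral>x. f x \<partial>M) - (\<Sum>j=1..n. measure M (S n j)) / n\<bar> \<le> 1 / n"
    if M: "real_distribution M" and n: "n > 0" for M and n :: nat
  proof -
    interpret real_distribution M by fact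
    have S' [measurable]: "S n j \<in> events" for j
      using S by simp
    have *: "\<bar>f x - (\<Sum>j=1..n. indicator (S n j) x) / n\<bar> \<le> 1 / n" for x
    proof -
      \<comment> \<open>The sum of indicators counts the levels \<open>j\<close> up to the floor of
        \<open>n * f x\<close>; since \<open>f x \<le> 1\<close>, stopping at level \<open>n\<close>
        loses none.\<close>
      have "n * f x \<le> n"
        using f01(2)[of x] by (intro mult_left_le) auto
      then have "{1..n} \<inter> {j. real j \<le> n * f x} = {1..nat \<lfloor>n * f x\<rfloor>}"
        using f01(1)[of x] by (auto simp: le_nat_floor le_floor_iff) linarith+
      moreover have "(\<Sum>j=1..n. indicator (S n j) x) = real (card ({1..n} \<inter> {j. real j \<le> n * f x}))"
        by (simp add: S_def indicator_def of_bool_def sum.If_cases)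
      ultimately have "(\<Sum>j=1..n. indicator (S n j) x) = real (card {1..nat \<lfloor>n * f x\<rfloor>})"
        by (simp only:)
      then have "(\<Sum>j=1..n. indicator (S n j) x :: real) = of_int \<lfloor>n * f x\<rfloor>"
        using f01(1)[of x] by simp
      then have "f x - (\<Sum>j=1..n. indicator (S n j) x) / n = (n * f x - of_int \<lfloor>n * f x\<rfloor>) / n"
        using n by (simp add: field_simps)
      also have "\<bar>\<dots>\<bar> \<le> 1 / n"
      proof -
        have "\<bar>n * f x - of_int \<lfloor>n * f x\<rfloor>\<bar> \<le> 1"
          by linarith
        then show ?thesis
          by (simp add: abs_divide divide_right_mono)
      qed
      finally show ?thesis .
    qed
    have int: "integrable M f"
      using f01 by (intro integrable_const_bound[where B = 1]) auto
    have int': "integrable M (\<lambda>x. (\<Sum>j=1..n. indicator (S n j) x) / n)"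
      by (intro integrable_divide integrable_sum integrable_real_indicator) (auto simp: emeasure_eq_measure)
    have "(\<integral>x. (\<Sum>j=1..n. indicator (S n j) x) / n \<partial>M) = (\<Sum>j=1..n. prob (S n j)) / n"
      by (simp add: Bochner_Integration.integral_sum emeasure_eq_measure)
    then have "\<bar>(\<integral>x. f x \<partial>M) - (\<Sum>j=1..n. prob (S n j)) / n\<bar>
        = \<bar>\<integral>x. f x - (\<Sum>j=1..n. indicator (S n j) x) / n \<partial>M\<bar>"
      using int int' n by simp
    also have "\<dots> \<le> (\<integral>x. \<bar>f x - (\<Sum>j=1..n. indicator (S n j) x) / n\<bar> \<partial>M)"
      by (rule integral_abs_bound)
    also have "\<dots> \<le> (\<integral>x. 1 / n \<partial>M)"
      using * int int' by (intro integral_mono) auto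
    also have "\<dots> = 1 / n"
      using prob_space by simp
    finally show ?thesis .
  qed
  \<comment> \<open>Discretizing each of the two integrals costs \<open>1 / Suc n\<close>.\<close>
  have "\<bar>(\<integral>x. f x \<partial>P) - (\<integral>x. f x \<partial>Q)\<bar> \<le> tv_dist P Q + 2 / Suc n" for n
  proof -
    let ?n = "Suc n"
    have "\<bar>(\<Sum>j=1..?n. measure P (S ?n j)) - (\<Sum>j=1..?n. measure Q (S ?n j))\<bar>
        \<le> (\<Sum>j=1..?n. \<bar>measure P (S ?n j) - measure Q (S ?n j)\<bar>)"
      unfolding sum_subtractf[symmetric] by (rule sum_abs)
    also have "\<dots> \<le> ?n * tv_dist P Q"
      using sum_bounded_above[of "{1..?n}" "\<lambda>j. \<bar>measure P (S ?n j) - measure Q (S ?n j)\<bar>" "tv_dist P Q"]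
        measure_diff_le_tv_dist[OF P Q S] by simp
    finally have "\<bar>(\<Sum>j=1..?n. measure P (S ?n j)) / ?n - (\<Sum>j=1..?n. measure Q (S ?n j)) / ?n\<bar>
        \<le> tv_dist P Q"
      unfolding diff_divide_distrib[symmetric] abs_divide
      by (simp add: divide_le_eq mult.commute del: of_nat_Suc)
    then show ?thesis
      using approx[OF P, of ?n] approx[OF Q, of ?n] by (simp del: of_nat_Suc sum.cl_ivl_Suc)
  qed
  moreover have "(\<lambda>n. tv_dist P Q + 2 / Suc n) \<longlonglongrightarrow> tv_dist P Q + 0"
    by (intro tendsto_add tendsto_const LIMSEQ_Suc[OF lim_const_over_n])
  ultimately show ?thesis
    by (intro LIMSEQ_le_const[where X = "\<lambda>n. tv_dist P Q + 2 / Suc n"]) auto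
qed

lemma (in real_distribution) Re_char: "Re (char M \<xi>) = (\<integral>x. cos (\<xi> * x) \<partial>M)"
proof -
  have "integrable M (\<lambda>x. iexp (\<xi> * x))"
    by (rule integrable_iexp) auto
  then have "Re (char M \<xi>) = (\<integral>x. Re (iexp (\<xi> * x)) \<partial>M)"
    unfolding char_def by (rule integral_Re[symmetric])
  then show ?thesis
    by (simp add: Re_exp)
qed

lemma (in real_distribution) Im_char: "Im (char M \<xi>) = (\<integral>x. sin (\<xi> * x) \<partial>M)"
proof -
  have "integrable M (\<lambda>x. iexp (\<xi> * x))"
    by (rule integrable_iexp) auto
  then have "Im (char M \<xi>) = (\<integral>x. Im (iexp (\<xi> * x)) \<partial>M)"
    unfolding char_def by (rule integral_Im[symmetric])
  then show ?thesis
    by (simp add: Im_exp)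
qed

text \<open>The factor \<open>2\<close> is the oscillation of the cosine:
  \<open>(1 + cos (\<xi> * x)) / 2\<close> takes values between \<open>0\<close> and
  \<open>1\<close>, so \<open>integral_diff_le_tv_dist\<close> applies to it.\<close>

lemma Re_char_diff_le_tv_dist:
  assumes P: "real_distribution P" and Q: "real_distribution Q"
  shows "\<bar>Re (char P \<xi>) - Re (char Q \<xi>)\<bar> \<le> 2 * tv_dist P Q"
proof -
  have half: "(\<integral>x. (1 + cos (\<xi> * x)) / 2 \<partial>M) = (1 + Re (char M \<xi>)) / 2" if "real_distribution M" for M
  proof -
    interpret real_distribution M by fact
    have "integrable M (\<lambda>x. cos (\<xi> * x))"
      by (rule integrable_const_bound[where B = 1]) auto
    then show ?thesis
      using prob_space by (simp add: Re_char)
  qed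
  have "\<bar>(\<integral>x. (1 + cos (\<xi> * x)) / 2 \<partial>P) - (\<integral>x. (1 + cos (\<xi> * x)) / 2 \<partial>Q)\<bar> \<le> tv_dist P Q"
  proof (rule integral_diff_le_tv_dist[OF P Q])
    show "0 \<le> (1 + cos (\<xi> * x)) / 2" for x
      using add_left_mono[OF cos_ge_minus_one, of 1 "\<xi> * x"] by simp
    show "(1 + cos (\<xi> * x)) / 2 \<le> 1" for x
      using add_left_mono[OF cos_le_one, of 1 "\<xi> * x"] by simp
  qed measurable
  then show ?thesis
    unfolding half[OF P] half[OF Q] by (simp add: abs_le_iff field_simps)
qed

lemma real_distribution_gaussian: "\<sigma> > 0 \<Longrightarrow> real_distribution (gaussian \<sigma>)"
  unfolding gaussian_def real_distribution_def real_distribution_axioms_def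
  by (auto intro: prob_space_normal_density)

text \<open>The measure is the image of the standard normal law under scaling by
  \<open>\<sigma>\<close>, which rescales the frequency.\<close>

lemma char_gaussian:
  assumes "\<sigma> > 0"
  shows "char (gaussian \<sigma>) \<xi> = exp (- (\<sigma> * \<xi>)\<^sup>2 / 2)"
proof -
  interpret N: real_distribution std_normal_distribution
    by (rule real_dist_normal_dist)
  have "distributed std_normal_distribution lborel (\<lambda>x. x) std_normal_density"
    unfolding distributed_def by (auto simp: distr_id2)
  from N.normal_density_affine[OF this, of \<sigma> 0] assms
  have "distr std_normal_distribution lborel (\<lambda>x. \<sigma> * x) = gaussian \<sigma>"
    by (auto simp: gaussian_def distributed_def)
  then have "char (gaussian \<sigma>) \<xi> = (CLINT x|std_normal_distribution. iexp (\<xi> * (\<sigma> * x)))"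
    by (simp add: char_def integral_distr flip: \<open>_ = gaussian \<sigma>\<close>)
  also have "\<dots> = char std_normal_distribution (\<sigma> * \<xi>)"
    by (simp add: char_def mult_ac)
  also have "\<dots> = exp (- (\<sigma> * \<xi>)\<^sup>2 / 2)"
    by (simp add: char_std_normal_distribution)
  finally show ?thesis .
qed

section \<open>Moments of the symmetrized measure\<close>

declare sets_symmetrized [measurable_cong]

text \<open>Preimages under \<open>abs\<close> are symmetric about \<open>0\<close>, and on
  symmetric sets the two measures agree. Even moments factor through \<open>abs\<close>, hence
  coincide.\<close>

lemma distr_abs_symmetrized:
  assumes "real_distribution M"
  shows "distr (symmetrized M) borel abs = distr M borel abs"
proof -
  interpret real_distribution M by fact
  show ?thesis
  proof (rule measure_eqI)
    fix B assume "B \<in> sets (distr (symmetrized M) borel abs)"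
    then have [measurable]: "B \<in> sets borel" by simp
    have "abs -` B \<in> sets (borel :: real measure)"
      using measurable_sets[of abs borel borel B] by simp
    moreover have "{x. - x \<in> abs -` B} = (abs -` B :: real set)"
      by auto
    moreover have "(a + a) / 2 = a" for a :: ennreal
      using mult_divide_eq_ennreal[of 2 a] unfolding mult_2_right by simp
    ultimately have "emeasure (symmetrized M) (abs -` B) = emeasure M (abs -` B)"
      using emeasure_symmetrized[OF assms] by simp
    then show "emeasure (distr (symmetrized M) borel abs) B = emeasure (distr M borel abs) B"
      by (simp add: emeasure_distr)
  qed simp
qed

lemma distr_uminus_symmetrized:
  assumes "real_distribution M"
  shows "distr (symmetrized M) borel uminus = symmetrized M"
proof (rule measure_eqI)
  fix B assume "B \<in> sets (distr (symmetrized M) borel uminus)"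
  then have B [measurable]: "B \<in> sets borel" by simp
  have U: "uminus -` B \<in> sets (borel :: real measure)"
    using measurable_sets[of uminus borel borel B] by simp
  show "emeasure (distr (symmetrized M) borel uminus) B = emeasure (symmetrized M) B"
    using emeasure_symmetrized[OF assms U] emeasure_symmetrized[OF assms B]
    by (simp add: emeasure_distr vimage_def add.commute)
qed simp

text \<open>Symmetrization keeps the even moments and makes the mean vanish, so the central moments
  become raw moments of \<open>M\<close>.\<close>

lemma fourth_cumulant_symmetrized:
  assumes "real_distribution M"
  shows "fourth_cumulant (symmetrized M) = (\<integral>x. x ^ 4 \<partial>M) - 3 * (\<integral>x. x\<^sup>2 \<partial>M)\<^sup>2"
proof -
  interpret real_distribution M by fact
  have even: "(\<integral>x. x ^ n \<partial>symmetrized M) = (\<integral>x. x ^ n \<partial>M)" if "even n" for n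
  proof -
    have "(\<integral>x. x ^ n \<partial>symmetrized M) = (\<integral>x. x ^ n \<partial>distr (symmetrized M) borel abs)"
      using that by (subst integral_distr) (auto simp: power_even_abs)
    also have "\<dots> = (\<integral>x. x ^ n \<partial>M)"
      unfolding distr_abs_symmetrized[OF assms] using that
      by (subst integral_distr) (auto simp: power_even_abs)
    finally show ?thesis .
  qed
  have "(\<integral>x. x \<partial>symmetrized M) = (\<integral>x. x \<partial>distr (symmetrized M) borel uminus)"
    by (simp add: distr_uminus_symmetrized[OF assms])
  also have "\<dots> = - (\<integral>x. x \<partial>symmetrized M)"
    by (subst integral_distr) auto
  finally have "(\<integral>x. x \<partial>symmetrized M) = 0"
    by simp
  then show ?thesis
    by (simp add: fourth_cumulant_def Let_def even)
qed

section \<open>Fourth-order expansions at frequency zero\<close>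

lemma exp_minus_half_square_expansion:
  assumes "\<sigma> > 0"
  shows "((\<lambda>t. (exp (- (\<sigma> * t)\<^sup>2 / 2) - 1 + \<sigma>\<^sup>2 * t\<^sup>2 / 2) / t ^ 4) \<longlongrightarrow> \<sigma> ^ 4 / 8) (at (0::real))"
  using assms by real_asymp

text \<open>Taylor expansion of the characteristic function to order four; in the real part the odd
  powers of \<open>\<i>\<close> drop out. The remainder is \<open>o(t ^ 4)\<close> by dominated
  convergence.\<close>

lemma (in real_distribution) Re_char_expansion:
  assumes int4: "integrable M (\<lambda>x. x ^ 4)"
  shows "((\<lambda>t. (Re (char M t) - 1 + (\<integral>x. x\<^sup>2 \<partial>M) * t\<^sup>2 / 2) / t ^ 4)
    \<longlongrightarrow> (\<integral>x. x ^ 4 \<partial>M) / 24) (at 0)"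
proof -
  have int: "integrable M (\<lambda>x. x ^ k)" if "k \<le> 4" for k
  proof (rule Bochner_Integration.integrable_bound)
    show "integrable M (\<lambda>x. 1 + x ^ 4)"
      using int4 by simp
    have "\<bar>x ^ k\<bar> \<le> 1 + x ^ 4" for x :: real
    proof (cases "\<bar>x\<bar> \<le> 1")
      case True
      then show ?thesis
        using power_le_one[of "\<bar>x\<bar>" k] by (simp add: power_abs add_increasing2)
    next
      case False
      then show ?thesis
        using power_increasing[OF that, of "\<bar>x\<bar>"] by (simp add: power_abs)
    qed
    then show "AE x in M. norm (x ^ k) \<le> norm (1 + x ^ 4)"
      by simp
  qed simp
  let ?m2 = "\<integral>x. x\<^sup>2 \<partial>M" and ?m4 = "\<integral>x. x ^ 4 \<partial>M"
  \<comment> \<open>This is the remainder integral of \<open>char_approx2\<close>. The second entry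
    of the minimum makes the integrand vanish as \<open>t\<close> tends to \<open>0\<close>; the
    first gives the integrable majorant \<open>10 * x ^ 4\<close>.\<close>
  define e where "e t = (\<integral>x. min (2 * \<bar>x\<bar> ^ 4 * real (Suc 4)) (\<bar>t\<bar> * \<bar>x\<bar> ^ Suc 4) \<partial>M)" for t
  have "isCont e 0"
    unfolding continuous_at_sequentially
  proof safe
    fix X :: "nat \<Rightarrow> real" assume X: "X \<longlonglongrightarrow> 0"
    show "(e \<circ> X) \<longlonglongrightarrow> e 0"
      unfolding comp_def e_def
      by (rule integral_dominated_convergence[where w = "\<lambda>x. 10 * x ^ 4"])
        (use int4 in \<open>auto intro!: tendsto_eq_intros X tendsto_min[THEN tendsto_eq_rhs] AE_I2 simp: abs_mult\<close>)
  qed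
  moreover have "e 0 = 0"
    by (simp add: e_def)
  ultimately have e0: "(e \<longlongrightarrow> 0) (at 0)"
    by (simp add: isCont_def)
  have le: "\<bar>Re (char M t) - (1 - ?m2 * t\<^sup>2 / 2 + ?m4 * t ^ 4 / 24)\<bar> \<le> t ^ 4 / 120 * e t" for t
  proof -
    have "1 - ?m2 * t\<^sup>2 / 2 + ?m4 * t ^ 4 / 24
        = Re (\<Sum>k\<le>4. ((\<i> * t) ^ k / fact k) * complex_of_real (\<integral>x. x ^ k \<partial>M))"
      using prob_space by (simp add: numeral_eq_Suc Re_divide Im_divide mult_ac)
    then have "\<bar>Re (char M t) - (1 - ?m2 * t\<^sup>2 / 2 + ?m4 * t ^ 4 / 24)\<bar>
        \<le> cmod (char M t - (\<Sum>k\<le>4. ((\<i> * t) ^ k / fact k) * complex_of_real (\<integral>x. x ^ k \<partial>M)))"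
      by (metis abs_Re_le_cmod minus_complex.sel(1))
    also have "\<dots> \<le> \<bar>t\<bar> ^ 4 / fact (Suc 4) * e t"
      unfolding e_def by (rule char_approx2[OF int])
    finally show ?thesis
      by (simp add: fact_numeral)
  qed
  have "((\<lambda>t. (Re (char M t) - 1 + ?m2 * t\<^sup>2 / 2) / t ^ 4 - ?m4 / 24) \<longlongrightarrow> 0) (at 0)"
  proof (rule Lim_null_comparison)
    show "\<forall>\<^sub>F t in at 0. norm ((Re (char M t) - 1 + ?m2 * t\<^sup>2 / 2) / t ^ 4 - ?m4 / 24) \<le> e t / 120"
    proof (rule eventually_mono[OF eventually_neq_at_within])
      fix t :: real assume "t \<noteq> 0"
      then have "(Re (char M t) - 1 + ?m2 * t\<^sup>2 / 2) / t ^ 4 - ?m4 / 24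
          = (Re (char M t) - (1 - ?m2 * t\<^sup>2 / 2 + ?m4 * t ^ 4 / 24)) / t ^ 4"
        by (simp add: field_simps)
      also have "\<bar>\<dots>\<bar> \<le> e t / 120"
        using le[of t] \<open>t \<noteq> 0\<close> by (simp add: abs_divide divide_le_eq mult.commute)
      finally show "norm ((Re (char M t) - 1 + ?m2 * t\<^sup>2 / 2) / t ^ 4 - ?m4 / 24) \<le> e t / 120"
        by simp
    qed
    show "((\<lambda>t. e t / 120) \<longlongrightarrow> 0) (at 0)"
      using e0 by (auto intro!: tendsto_eq_intros)
  qed
  then show ?thesis
    by (rule Lim_null[THEN iffD2])
qed

section \<open>Reduction to the real part\<close>

lemma (in real_distribution) Re_kac_star_char:
  "Re (kac_star (char M) (char M) \<xi>) = circle_mean (\<lambda>\<theta>. Re (char M (\<xi> * cos \<theta>)) * Re (char M (\<xi> * sin \<theta>)))"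
proof -
  have cont: "continuous_on UNIV (char M)"
    by (intro continuous_at_imp_continuous_on ballI isCont_char)
  let ?p = "\<lambda>\<theta>. Im (char M (\<xi> * cos \<theta>)) * Im (char M (\<xi> * sin \<theta>))"
  let ?q = "\<lambda>\<theta>. Re (char M (\<xi> * cos \<theta>)) * Re (char M (\<xi> * sin \<theta>))"
  let ?f = "\<lambda>\<theta>. char M (\<xi> * cos \<theta>) * char M (\<xi> * sin \<theta>)"
  have f: "continuous_on {0..2 * pi} ?f" and p: "continuous_on {0..2 * pi} ?p" and q: "continuous_on {0..2 * pi} ?q"
    by (intro continuous_intros continuous_on_compose2[OF cont]; auto)+
  \<comment> \<open>The Lebesgue integral of \<open>kac_star\<close> equals the gauge integral of
    \<open>circle_mean\<close> because the integrand is continuous.\<close>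
  have "Re (kac_star (char M) (char M) \<xi>) = Re (integral {0..2 * pi} ?f) / (2 * pi)"
    using set_borel_integral_eq_integral(2)[OF borel_integrable_atLeastAtMost'[OF f]] by (simp add: kac_star_def)
  also have "Re (integral {0..2 * pi} ?f) = integral {0..2 * pi} (\<lambda>\<theta>. ?q \<theta> - ?p \<theta>)"
    using integral_linear[OF integrable_continuous_interval[OF f] bounded_linear_Re]
    by (simp add: comp_def)
  also have "\<dots> = integral {0..2 * pi} ?q - integral {0..2 * pi} ?p"
    using p q by (intro integral_diff integrable_continuous_interval)
  \<comment> \<open>The reflection \<open>2 * pi - x\<close> preserves the cosine and negates the
    sine; as \<open>Im (char M \<xi>)\<close> is odd in \<open>\<xi>\<close>, the integral equals
    its own negative.\<close>
  also have "integral {0..2 * pi} ?p = 0"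
  proof -
    have "(\<lambda>x. 2 * pi - x) ` {0..2 * pi} = {0..2 * pi}"
      by simp
    with has_integral_affinity[of ?p "integral {0..2 * pi} ?p" 0 "2 * pi" "- 1" "2 * pi"]
      integrable_integral[OF integrable_continuous_interval[OF p]]
    have "((\<lambda>x. ?p (2 * pi - x)) has_integral integral {0..2 * pi} ?p) {0..2 * pi}"
      by (simp add: add.commute)
    moreover have "?p (2 * pi - x) = - ?p x" for x
      by (simp add: Im_char cos_diff sin_diff)
    ultimately have "((\<lambda>x. - ?p x) has_integral integral {0..2 * pi} ?p) {0..2 * pi}"
      by simp
    then have "integral {0..2 * pi} (\<lambda>x. - ?p x) = integral {0..2 * pi} ?p"
      by (rule integral_unique)
    then show ?thesis
      by simp
  qed
  finally show ?thesis
    by (simp add: circle_mean_def)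
qed

lemma kac_solution_Re_char_deriv:
  assumes sol: "kac_solution \<mu>0 \<mu>" and t: "t \<ge> 0"
  shows "((\<lambda>t. Re (char (\<mu> t) \<xi>)) has_real_derivative
    circle_mean (\<lambda>\<theta>. Re (char (\<mu> t) (\<xi> * cos \<theta>)) * Re (char (\<mu> t) (\<xi> * sin \<theta>)))
      - Re (char (\<mu> t) \<xi>)) (at t within {0..})"
proof -
  interpret real_distribution "\<mu> t"
    using sol t by (simp add: kac_solution_def)
  have "((\<lambda>s. char (\<mu> s) \<xi>) has_vector_derivative
      kac_star (char (\<mu> t)) (char (\<mu> t)) \<xi> - char (\<mu> t) \<xi>) (at t within {0..})"
    using sol t by (simp add: kac_solution_def kac_fourier_solution_def)
  from bounded_linear.has_vector_derivative[OF bounded_linear_Re this] show ?thesis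
    by (simp add: has_real_derivative_iff_has_vector_derivative Re_kac_star_char)
qed

section \<open>The lower bound from a single frequency\<close>

theorem theorem2p1:
  fixes \<mu>0 :: "real measure" and \<sigma> :: real
  assumes "real_distribution \<mu>0"
    and "integrable \<mu>0 (\<lambda>x. x ^ 4)"
    and "fourth_cumulant (symmetrized \<mu>0) \<noteq> 0"
    and "\<sigma> = sqrt (\<integral>x. x\<^sup>2 \<partial>\<mu>0)"
  shows "\<exists>C>0. \<forall>\<mu>. kac_solution \<mu>0 \<mu> \<longrightarrow>
           (\<forall>t\<ge>0. tv_dist (\<mu> t) (gaussian \<sigma>) \<ge> C * exp (- t / 4))"
proof -
  interpret M: real_distribution \<mu>0 by fact
  let ?m2 = "\<integral>x. x\<^sup>2 \<partial>\<mu>0" and ?m4 = "\<integral>x. x ^ 4 \<partial>\<mu>0"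
  define k where "k = (?m4 - 3 * ?m2\<^sup>2) / 24"
  have k: "k \<noteq> 0"
    using assms(3) by (simp add: k_def fourth_cumulant_symmetrized[OF assms(1)])
  \<comment> \<open>Otherwise \<open>\<mu>0\<close> would be concentrated at \<open>0\<close> and
    its fourth cumulant would vanish. Hence \<open>gaussian \<sigma>\<close> is a genuine
    probability measure.\<close>
  have "?m2 \<noteq> 0"
  proof
    assume 0: "?m2 = 0"
    have "integrable \<mu>0 (\<lambda>x. x\<^sup>2)"
      using assms(2) by (intro M.square_integrable_imp_integrable[of "\<lambda>x. x\<^sup>2"]) (auto simp flip: power_mult)
    with 0 have "AE x in \<mu>0. x = 0"
      by (subst (asm) integral_nonneg_eq_0_iff_AE) auto
    then have "?m4 = 0"
      by (intro integral_eq_zero_AE) auto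
    with 0 k show False
      by (simp add: k_def)
  qed
  then have "?m2 > 0"
    by (simp add: less_le)
  then have \<sigma>: "\<sigma> > 0" and \<sigma>2: "\<sigma>\<^sup>2 = ?m2"
    by (auto simp: assms(4))
  \<comment> \<open>Two errors of relative size \<open>\<epsilon>\<close> will occur, one from the
    expansion and one from the nonlinearity; together they use up half of
    \<open>\<bar>k\<bar>\<close>.\<close>
  define \<epsilon> where "\<epsilon> = \<bar>k\<bar> / 4"
  have \<epsilon>: "\<epsilon> > 0"
    using k by (simp add: \<epsilon>_def)
  define g where "g \<xi> = exp (- (\<sigma> * \<xi>)\<^sup>2 / 2)" for \<xi>
  \<comment> \<open>The quadratic terms cancel by the choice of \<open>\<sigma>\<close>, and
    \<open>?m4 / 24 - \<sigma> ^ 4 / 8 = k\<close> remains.\<close>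
  have "((\<lambda>t. (Re (char \<mu>0 t) - g t) / t ^ 4) \<longlongrightarrow> k) (at 0)"
  proof -
    have "\<sigma> ^ 4 = ?m2\<^sup>2"
      unfolding \<sigma>2[symmetric] by (simp flip: power_mult)
    then have "?m4 / 24 - \<sigma> ^ 4 / 8 = k"
      by (simp add: k_def field_simps)
    with tendsto_diff[OF M.Re_char_expansion[OF assms(2)] exp_minus_half_square_expansion[OF \<sigma>]]
    show ?thesis
      by (simp add: \<sigma>2 g_def flip: diff_divide_distrib)
  qed
  then have "\<forall>\<^sub>F t in at 0. \<bar>(Re (char \<mu>0 t) - g t) / t ^ 4 - k\<bar> < \<epsilon>"
    using \<epsilon> by (auto dest: tendstoD simp: dist_real_def)
  then obtain d where d: "d > 0"
    and near: "\<And>t. t \<noteq> 0 \<Longrightarrow> \<bar>t\<bar> < d \<Longrightarrow> \<bar>(Re (char \<mu>0 t) - g t) / t ^ 4 - k\<bar> < \<epsilon>"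
    by (auto simp: eventually_at dist_real_def)
  define r where "r = min 1 (d / 2)"
  have r: "0 < r" "r \<le> 1" "r < d"
    using d by (auto simp: r_def)
  have init: "\<bar>Re (char \<mu>0 \<xi>) - g \<xi> - k * \<xi> ^ 4\<bar> \<le> \<epsilon> * \<xi> ^ 4" if "\<bar>\<xi>\<bar> \<le> r" for \<xi>
  proof (cases "\<xi> = 0")
    case True
    then show ?thesis
      by (simp add: g_def M.char_zero)
  next
    case False
    then have "Re (char \<mu>0 \<xi>) - g \<xi> - k * \<xi> ^ 4 = ((Re (char \<mu>0 \<xi>) - g \<xi>) / \<xi> ^ 4 - k) * \<xi> ^ 4"
      by (simp add: field_simps)
    also have "\<bar>\<dots>\<bar> \<le> \<epsilon> * \<xi> ^ 4"
      using near[of \<xi>] False that r by (simp add: abs_mult mult_right_mono)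
    finally show ?thesis .
  qed
  define D where "D = (\<bar>k\<bar> + \<epsilon>) * (\<bar>k\<bar> + \<epsilon> + \<sigma>\<^sup>2 / 2)"
  have D: "D \<ge> 0"
    using \<epsilon> by (simp add: D_def)
  \<comment> \<open>Small enough for \<open>D * \<xi>\<^sup>2 \<le> \<epsilon>\<close>; adding
    \<open>1\<close> to \<open>D\<close> keeps the denominator positive. The frequency is fixed
    before \<open>\<mu>\<close> and \<open>t\<close>.\<close>
  define \<xi> where "\<xi> = min r (sqrt (\<epsilon> / (D + 1)))"
  have \<xi>: "\<xi> > 0" "\<bar>\<xi>\<bar> \<le> r"
    using r \<epsilon> D by (auto simp: \<xi>_def)
  have "\<xi>\<^sup>2 \<le> (sqrt (\<epsilon> / (D + 1)))\<^sup>2"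
    using \<xi> by (intro power_mono) (auto simp: \<xi>_def)
  also have "\<dots> = \<epsilon> / (D + 1)"
    using \<epsilon> D by simp
  finally have "D * \<xi>\<^sup>2 \<le> D * (\<epsilon> / (D + 1))"
    using D by (rule mult_left_mono)
  also have "\<dots> \<le> \<epsilon>"
    using D \<epsilon> by (simp add: field_simps)
  finally have D\<xi>: "D * \<xi>\<^sup>2 \<le> \<epsilon>" .
  show ?thesis
  \<comment> \<open>Of the leading coefficient \<open>\<bar>k\<bar> * \<xi> ^ 4\<close> half
    survives the errors, and the factor \<open>2\<close> in \<open>Re_char_diff_le_tv_dist\<close>
    halves it again.\<close>
  proof (intro exI[of _ "\<bar>k\<bar> * \<xi> ^ 4 / 4"] conjI allI impI)
    show "\<bar>k\<bar> * \<xi> ^ 4 / 4 > 0"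
      using k \<xi> by simp
    fix \<mu> and t :: real
    assume sol: "kac_solution \<mu>0 \<mu>" and t: "t \<ge> 0"
    have rd: "real_distribution (\<mu> t)" if "t \<ge> 0" for t
      using sol that by (simp add: kac_solution_def)
    have "\<bar>Re (char (\<mu> t) \<xi>) - g \<xi> - k * \<xi> ^ 4 * exp (- t / 4)\<bar>
        \<le> (\<epsilon> * \<xi> ^ 4 + D * \<xi> ^ 6) * exp (- t / 4)"
      unfolding g_def D_def
    proof (rule kac_near_gaussian[where u = "\<lambda>\<xi> t. Re (char (\<mu> t) \<xi>)", OF kac_solution_Re_char_deriv[OF sol]])
      fix s :: real assume s: "s \<ge> 0"
      interpret real_distribution "\<mu> s"
        by (rule rd[OF s])
      show "continuous_on UNIV (\<lambda>\<xi>. Re (char (\<mu> s) \<xi>))"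
        by (intro continuous_intros continuous_at_imp_continuous_on ballI isCont_char)
      show "\<bar>Re (char (\<mu> s) \<xi>)\<bar> \<le> 1" for \<xi>
        using abs_Re_le_cmod cmod_char_le_1 by (rule order_trans)
    next
      have "char (\<mu> 0) x = char \<mu>0 x" for x
        using sol by (simp add: kac_solution_def kac_fourier_solution_def)
      then show "\<bar>Re (char (\<mu> 0) x) - exp (- (\<sigma> * x)\<^sup>2 / 2) - k * x ^ 4\<bar> \<le> \<epsilon> * x ^ 4"
        if "\<bar>x\<bar> \<le> r" for x
        using init[OF that] by (simp add: g_def)
    qed (use r \<epsilon> \<xi> t in auto)
    also have "(\<epsilon> * \<xi> ^ 4 + D * \<xi> ^ 6) * exp (- t / 4) = (\<epsilon> + D * \<xi>\<^sup>2) * (\<xi> ^ 4 * exp (- t / 4))"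
      by (simp add: algebra_simps flip: power_add)
    also have "\<dots> \<le> (\<epsilon> + \<epsilon>) * (\<xi> ^ 4 * exp (- t / 4))"
      using D\<xi> by (intro mult_right_mono) auto
    also have "\<dots> = \<bar>k\<bar> / 2 * (\<xi> ^ 4 * exp (- t / 4))"
      by (simp add: \<epsilon>_def)
    finally have "\<bar>Re (char (\<mu> t) \<xi>) - g \<xi> - k * \<xi> ^ 4 * exp (- t / 4)\<bar>
        \<le> \<bar>k\<bar> / 2 * (\<xi> ^ 4 * exp (- t / 4))" .
    moreover have "\<bar>k * \<xi> ^ 4 * exp (- t / 4)\<bar> = \<bar>k\<bar> * (\<xi> ^ 4 * exp (- t / 4))"
      by (simp add: abs_mult)
    moreover have "\<bar>Re (char (\<mu> t) \<xi>) - g \<xi>\<bar> \<le> 2 * tv_dist (\<mu> t) (gaussian \<sigma>)"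
      using Re_char_diff_le_tv_dist[OF rd[OF t] real_distribution_gaussian[OF \<sigma>], of \<xi>]
      by (simp add: char_gaussian[OF \<sigma>] g_def)
    ultimately have "\<bar>k\<bar> * (\<xi> ^ 4 * exp (- t / 4))
        \<le> \<bar>k\<bar> / 2 * (\<xi> ^ 4 * exp (- t / 4)) + 2 * tv_dist (\<mu> t) (gaussian \<sigma>)"
      using abs_triangle_ineq3[of "k * \<xi> ^ 4 * exp (- t / 4)" "Re (char (\<mu> t) \<xi>) - g \<xi>"]
      unfolding abs_minus_commute[of "k * \<xi> ^ 4 * exp (- t / 4)"] by linarith
    then show "tv_dist (\<mu> t) (gaussian \<sigma>) \<ge> \<bar>k\<bar> * \<xi> ^ 4 / 4 * exp (- t / 4)"
      by simp
  qed
qed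

end
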